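(* Let $G$ be a finite weighted graph with vertex set $V$ and graph Laplacian $\mathcal{L}$. Let $U\subset V$ be any set of vertices, $\varepsilon>0$, $k=2^l$ with $l\in\mathbb{N}$, $f\in L_2(G)$ and $R>0$. Let $\theta_u=\theta_u(U,k,\varepsilon)=\sum_{v\in V}L^{U,u}_{k,\varepsilon}(v)$, $u\in U$. Then for any $g\in Q(U,f,k,\varepsilon,R)$, $$\sum_{u\in U}g(u)\theta_u=\frac{a+b}{2},$$ where $[a,b]$ is the interval $$[a,b]=\left\{\sum_{v\in V}h(v):\ h\in Q(U,f,k,\varepsilon,R)\right\}.$$
   Context: $G$ is an undirected weighted graph with finite vertex set $V=V(G)$ and symmetric weight function $w:V\times V\to[0,\infty)$, $w(u,v)=w(v,u)$, $w(u,u)=0$; pairs with $w(u,v)\neq0$ are edges. $L_2(G)$ is the space of real-valued functions on $V$ with inner product $\langle f,g\rangle=\sum_{v\in V}f(v)g(v)$ and norm $\|f\|=\left(\sum_{v\in V}|f(v)|^2\right)^{1/2}$. The Laplacian is $(\mathcal{L}f)(v)=\sum_{u\in V}(f(v)-f(u))w(v,u)$, a positive-semidefinite self-adjoint operator on $L_2(G)$. Variational splines: given $U\subset V$, $k\in\mathbb{N}$, $\varepsilon>0$ and real numbers $y=\{y_u\}_{u\in U}$, the variational spline $Y^{U,y}_{k,\varepsilon}$ is the unique function $Y\in L_2(G)$ with $Y(u)=y_u$ for all $u\in U$ which minimizes $\|(\varepsilon I+\mathcal{L})^kY\|$ among all functions satisfying these constraints. For $u\in U$, the Lagrangian spline $L^{U,u}_{k,\varepsilon}$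 is the variational spline with the constraints $L^{U,u}_{k,\varepsilon}(v)=\delta_{u,v}$ (Kronecker delta) for $v\in U$. $Q(U,f,k,\varepsilon,R)$ denotes the set of all $h\in L_2(G)$ such that (1) $h(u)=f(u)$ for all $u\in U$ and (2) $\|(\varepsilon I+\mathcal{L})^kh\|\le R$. This set is convex, bounded and closed, so (when it is non-empty) the set of sums $\sum_{v\in V}h(v)$, $h\in Q(U,f,k,\varepsilon,R)$, is a closed bounded interval $[a,b]$ (possibly degenerate). *)

theory Defs
  imports "HOL-Analysis.Analysis"
begin

text \<open>
  The vertex set is the finite type \<open>'v\<close>, and the space \<open>L\<^sub>2(G)\<close> is \<open>real ^ 'v\<close>, whose library
  inner product and norm are the unweighted \<open>\<ell>\<^sup>2\<close> ones.
\<close>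

definition weighted_graph :: "('v::finite \<Rightarrow> 'v \<Rightarrow> real) \<Rightarrow> bool" where
  "weighted_graph w \<longleftrightarrow> (\<forall>u v. 0 \<le> w u v) \<and> (\<forall>u v. w u v = w v u) \<and> (\<forall>u. w u u = 0)"

definition laplacian :: "('v::finite \<Rightarrow> 'v \<Rightarrow> real) \<Rightarrow> real ^ 'v \<Rightarrow> real ^ 'v" where
  "laplacian w f = (\<chi> v. \<Sum>u\<in>UNIV. (f $ v - f $ u) * w v u)"

definition shifted_laplacian :: "('v::finite \<Rightarrow> 'v \<Rightarrow> real) \<Rightarrow> real \<Rightarrow> real ^ 'v \<Rightarrow> real ^ 'v" where
  "shifted_laplacian w \<epsilon> f = \<epsilon> *\<^sub>R f + laplacian w f"

definition is_variational_spline ::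
  "('v::finite \<Rightarrow> 'v \<Rightarrow> real) \<Rightarrow> 'v set \<Rightarrow> ('v \<Rightarrow> real) \<Rightarrow> nat \<Rightarrow> real \<Rightarrow> real ^ 'v \<Rightarrow> bool" where
  "is_variational_spline w U y k \<epsilon> Y \<longleftrightarrow>
     (\<forall>u\<in>U. Y $ u = y u) \<and>
     (\<forall>Z. (\<forall>u\<in>U. Z $ u = y u) \<longrightarrow>
        norm ((shifted_laplacian w \<epsilon> ^^ k) Y) \<le> norm ((shifted_laplacian w \<epsilon> ^^ k) Z))"

text \<open>The description is meaningful for \<open>\<epsilon> > 0\<close>; see \<open>variational_spline_ex1\<close> below.\<close>

definition variational_spline ::
  "('v::finite \<Rightarrow> 'v \<Rightarrow> real) \<Rightarrow> 'v set \<Rightarrow> ('v \<Rightarrow> real) \<Rightarrow> nat \<Rightarrow> real \<Rightarrow> real ^ 'v" where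
  "variational_spline w U y k \<epsilon> = (THE Y. is_variational_spline w U y k \<epsilon> Y)"

definition lagrangian_spline ::
  "('v::finite \<Rightarrow> 'v \<Rightarrow> real) \<Rightarrow> 'v set \<Rightarrow> 'v \<Rightarrow> nat \<Rightarrow> real \<Rightarrow> real ^ 'v" where
  "lagrangian_spline w U u k \<epsilon> = variational_spline w U (\<lambda>v. if u = v then 1 else 0) k \<epsilon>"

definition spline_weight ::
  "('v::finite \<Rightarrow> 'v \<Rightarrow> real) \<Rightarrow> 'v set \<Rightarrow> nat \<Rightarrow> real \<Rightarrow> 'v \<Rightarrow> real" where
  "spline_weight w U k \<epsilon> u = (\<Sum>v\<in>UNIV. lagrangian_spline w U u k \<epsilon> $ v)"

definition Q_set ::
  "('v::finite \<Rightarrow> 'v \<Rightarrow> real) \<Rightarrow> 'v set \<Rightarrow> real ^ 'v \<Rightarrow> nat \<Rightarrow> real \<Rightarrow> real \<Rightarrow> (real ^ 'v) set" where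
  "Q_set w U f k \<epsilon> R =
     {h. (\<forall>u\<in>U. h $ u = f $ u) \<and> norm ((shifted_laplacian w \<epsilon> ^^ k) h) \<le> R}"

lemma linear_laplacian: "linear (laplacian w)"
proof (rule linearI)
  fix f g :: "real ^ 'a" and c :: real
  show "laplacian w (f + g) = laplacian w f + laplacian w g"
    by (simp add: laplacian_def vec_eq_iff sum.distrib[symmetric] algebra_simps)
  show "laplacian w (c *\<^sub>R f) = c *\<^sub>R laplacian w f"
    by (simp add: laplacian_def vec_eq_iff sum_distrib_left algebra_simps)
qed

lemma inner_laplacian_nonneg:
  assumes "weighted_graph w"
  shows "0 \<le> f \<bullet> laplacian w f"
proof -
  have sym: "w u v = w v u" and nn: "0 \<le> w u v" for u v
    using assms by (auto simp: weighted_graph_def)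
  let ?S = "\<Sum>v\<in>UNIV. \<Sum>u\<in>UNIV. f $ v * (f $ v - f $ u) * w v u"
  have 1: "f \<bullet> laplacian w f = ?S"
    by (simp add: inner_vec_def laplacian_def sum_distrib_left mult.assoc)
  have 2: "?S = (\<Sum>v\<in>UNIV. \<Sum>u\<in>UNIV. f $ u * (f $ u - f $ v) * w v u)"
    by (subst sum.swap, intro sum.cong refl, subst sym, rule refl)
  have "?S + ?S = ?S + (\<Sum>v\<in>UNIV. \<Sum>u\<in>UNIV. f $ u * (f $ u - f $ v) * w v u)"
    using 2 by (rule arg_cong)
  also have "\<dots> = (\<Sum>v\<in>UNIV. \<Sum>u\<in>UNIV. (f $ v - f $ u)\<^sup>2 * w v u)"
    unfolding sum.distrib[symmetric]
    by (intro sum.cong refl) (simp add: power2_eq_square algebra_simps)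
  also have "\<dots> \<ge> 0"
    by (intro sum_nonneg mult_nonneg_nonneg nn) auto
  finally show ?thesis using 1 by simp
qed

lemma linear_shifted_laplacian_power: "linear (shifted_laplacian w \<epsilon> ^^ k)"
proof (induction k)
  case 0
  show ?case by (simp add: linear_iff)
next
  case (Suc k)
  have "linear (shifted_laplacian w \<epsilon>)"
    unfolding shifted_laplacian_def
    by (intro linear_compose_add linear_laplacian linear_scale_self)
  from linear_compose[OF Suc.IH this] show ?case by (simp only: funpow.simps)
qed

lemma inj_shifted_laplacian_power:
  assumes "weighted_graph w" and "\<epsilon> > 0"
  shows "inj (shifted_laplacian w \<epsilon> ^^ k)"
proof -
  have lin: "linear (shifted_laplacian w \<epsilon>)"
    using linear_shifted_laplacian_power[where w = w and \<epsilon> = \<epsilon> and k = 1] by simp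
  have "f = 0" if "shifted_laplacian w \<epsilon> f = 0" for f
  proof -
    have "\<epsilon> * (f \<bullet> f) + f \<bullet> laplacian w f = f \<bullet> shifted_laplacian w \<epsilon> f"
      by (simp add: shifted_laplacian_def inner_add_right)
    then have "\<epsilon> * (f \<bullet> f) + f \<bullet> laplacian w f = 0"
      using that by simp
    then have "\<epsilon> * (f \<bullet> f) \<le> 0"
      using inner_laplacian_nonneg[OF assms(1), of f] by linarith
    then have "f \<bullet> f \<le> 0"
      using assms(2) by (simp add: mult_le_0_iff)
    then show ?thesis
      using inner_gt_zero_iff[of f] by linarith
  qed
  then have "inj (shifted_laplacian w \<epsilon>)"
    using linear_injective_0[OF lin] by blast
  then show ?thesis by (rule inj_fn)
qed

lemma variational_spline_ex1:
  assumes "weighted_graph w" and "\<epsilon> > 0"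
  shows "\<exists>!Y. is_variational_spline w U y k \<epsilon> Y"
proof -
  define A where "A = shifted_laplacian w \<epsilon> ^^ k"
  define S where "S = {Z :: real ^ 'a. \<forall>u\<in>U. Z $ u = y u}"
  have lin: "linear A" unfolding A_def by (rule linear_shifted_laplacian_power)
  have inj: "inj A" unfolding A_def by (rule inj_shifted_laplacian_power[OF assms])
  have "S = (\<Inter>u\<in>U. {Z. Z $ u = y u})" by (auto simp: S_def)
  moreover have "closed {Z :: real ^ 'a. Z $ u = y u}" for u
    by (intro closed_Collect_eq continuous_intros)
  ultimately have clS: "closed S" by auto
  have "convex S"
  proof (rule convexI)
    fix Z1 Z2 and s t :: real
    assume "Z1 \<in> S" "Z2 \<in> S" "s + t = 1"
    moreover from this(3) have "s * c + t * c = c" for c :: real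
      by (metis distrib_right mult_1)
    ultimately show "s *\<^sub>R Z1 + t *\<^sub>R Z2 \<in> S"
      by (simp add: S_def)
  qed
  then have cv: "convex (A ` S)" by (rule convex_linear_image[OF lin])
  have cl: "closed (A ` S)"
    using clS lin inj by (rule closed_injective_linear_image)
  have "(\<chi> v. y v) \<in> S" by (simp add: S_def)
  then have ne: "A ` S \<noteq> {}" by blast
  have eq: "is_variational_spline w U y k \<epsilon> Y \<longleftrightarrow> Y \<in> S \<and> (\<forall>z\<in>A ` S. dist 0 (A Y) \<le> dist 0 z)" for Y
    by (auto simp: is_variational_spline_def S_def A_def)
  obtain Y where Y: "Y \<in> S" "\<forall>z\<in>A ` S. dist 0 (A Y) \<le> dist 0 z"
  proof -
    have "closest_point (A ` S) 0 \<in> A ` S"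
      by (rule closest_point_in_set[OF cl ne])
    then obtain Y where Y: "Y \<in> S" "closest_point (A ` S) 0 = A Y" by blast
    have "\<forall>z\<in>A ` S. dist 0 (A Y) \<le> dist 0 z"
      unfolding Y(2)[symmetric] using closest_point_le[OF cl] by blast
    with Y(1) show thesis by (rule that)
  qed
  have "Z = Y" if "Z \<in> S" "\<forall>z\<in>A ` S. dist 0 (A Z) \<le> dist 0 z" for Z
  proof -
    have "A Z = A Y"
      by (rule any_closest_point_unique[OF cv cl imageI[OF that(1)] imageI[OF Y(1)] that(2) Y(2)])
    then show ?thesis using inj by (simp add: inj_eq)
  qed
  then have "Z = Y" if "is_variational_spline w U y k \<epsilon> Z" for Z
    using that[unfolded eq] by (elim conjE)
  moreover have "is_variational_spline w U y k \<epsilon> Y"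
    unfolding eq using Y by (rule conjI)
  ultimately show ?thesis by (intro ex1I)
qed

end

theory Submission
  imports Defs
begin

text \<open>
  Write \<open>A\<close> for the operator \<open>(\<epsilon> I + \<L>)\<^sup>k\<close>, and call two functions \<open>A\<close>-orthogonal if their
  images under \<open>A\<close> are orthogonal. Minimality makes every spline \<open>A\<close>-orthogonal to the
  functions that vanish on \<open>U\<close> (\<open>spline_orthogonal\<close>). The combination \<open>Y = (\<Sum>u\<in>U. f(u) L\<^sub>u)\<close> of
  the Lagrangian splines inherits this orthogonality, because \<open>A\<close> is linear, and it agrees with \<open>f\<close>
  on \<open>U\<close>. If \<open>h\<close> interpolates \<open>f\<close>, then \<open>h - Y\<close> vanishes on \<open>U\<close>, so \<open>A (h - Y)\<close> is orthogonal to
  \<open>A Y\<close>, and by Pythagoras the functions \<open>Y + (h - Y)\<close> and \<open>Y - (h - Y)\<close> have images under \<open>A\<close> of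
  the same norm. Hence \<open>h \<mapsto> 2 Y - h\<close> maps \<open>Q\<close> to itself: the function \<open>Y\<close> is a centre of symmetry of
  \<open>Q\<close> (\<open>Q_set_reflection\<close>).

  Summation over the vertices is linear, so it carries \<open>Q\<close> to a set of reals that is symmetric about
  \<open>(\<Sum>v. Y(v)) = (\<Sum>u\<in>U. f(u) \<theta>\<^sub>u)\<close>. As \<open>Q\<close> is convex and, by injectivity of \<open>A\<close>, compact, that set
  is a compact interval, and a non-empty interval is symmetric only about its midpoint.
\<close>

text \<open>This is the first-order condition for a minimum along a line. The proof substitutes the value
  of \<open>t\<close> at which \<open>norm (x + t *\<^sub>R z)\<close> is smallest.\<close>

lemma inner_eq_0_if_norm_minimal_on_line:
  fixes x z :: "'a::real_inner"
  assumes min: "\<And>t. norm x \<le> norm (x + t *\<^sub>R z)"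
  shows "x \<bullet> z = 0"
proof (cases "z = 0")
  case False
  then have pos: "z \<bullet> z > 0" by simp
  define t where "t = - (x \<bullet> z) / (z \<bullet> z)"
  have "x \<bullet> x \<le> (x + t *\<^sub>R z) \<bullet> (x + t *\<^sub>R z)"
    using min[of t] by (simp add: norm_le)
  also have "\<dots> = x \<bullet> x + t * (2 * (x \<bullet> z) + t * (z \<bullet> z))"
    by (simp add: inner_add_left inner_add_right inner_commute algebra_simps)
  also have "t * (z \<bullet> z) = - (x \<bullet> z)"
    using pos by (simp add: t_def)
  also have "x \<bullet> x + t * (2 * (x \<bullet> z) + - (x \<bullet> z)) = x \<bullet> x - (x \<bullet> z)\<^sup>2 / (z \<bullet> z)"
    by (simp add: t_def power2_eq_square)
  finally have "(x \<bullet> z)\<^sup>2 / (z \<bullet> z) \<le> 0" by simp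
  then show ?thesis by (simp add: pos_divide_le_eq[OF pos])
qed simp

text \<open>A multiple of a function vanishing on \<open>U\<close> can be added to a spline without violating its
  constraints, so the norm in question is minimal along each such line.\<close>

lemma spline_orthogonal:
  assumes Y: "is_variational_spline w U y k \<epsilon> Y" and Z: "\<forall>u\<in>U. Z $ u = 0"
  shows "(shifted_laplacian w \<epsilon> ^^ k) Y \<bullet> (shifted_laplacian w \<epsilon> ^^ k) Z = 0"
proof (rule inner_eq_0_if_norm_minimal_on_line)
  fix t :: real
  have "\<forall>u\<in>U. (Y + t *\<^sub>R Z) $ u = y u"
    using Y Z by (simp add: is_variational_spline_def)
  then have "norm ((shifted_laplacian w \<epsilon> ^^ k) Y) \<le> norm ((shifted_laplacian w \<epsilon> ^^ k) (Y + t *\<^sub>R Z))"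
    using Y unfolding is_variational_spline_def by blast
  then show "norm ((shifted_laplacian w \<epsilon> ^^ k) Y)
      \<le> norm ((shifted_laplacian w \<epsilon> ^^ k) Y + t *\<^sub>R (shifted_laplacian w \<epsilon> ^^ k) Z)"
    using linear_shifted_laplacian_power[of k w \<epsilon>] by (simp add: linear_add linear_scale)
qed

lemma is_variational_spline_lagrangian_spline:
  assumes "weighted_graph w" and "\<epsilon> > 0"
  shows "is_variational_spline w U (\<lambda>v. if u = v then 1 else 0) k \<epsilon> (lagrangian_spline w U u k \<epsilon>)"
  unfolding lagrangian_spline_def variational_spline_def
  by (rule theI'[OF variational_spline_ex1[OF assms]])

definition lagrangian_interpolant ::
  "('v::finite \<Rightarrow> 'v \<Rightarrow> real) \<Rightarrow> 'v set \<Rightarrow> real ^ 'v \<Rightarrow> nat \<Rightarrow> real \<Rightarrow> real ^ 'v" where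
  "lagrangian_interpolant w U f k \<epsilon> = (\<Sum>u\<in>U. f $ u *\<^sub>R lagrangian_spline w U u k \<epsilon>)"

lemma lagrangian_interpolant_nth:
  assumes "weighted_graph w" and "\<epsilon> > 0" and "v \<in> U"
  shows "lagrangian_interpolant w U f k \<epsilon> $ v = f $ v"
proof -
  have "lagrangian_spline w U u k \<epsilon> $ v = (if u = v then 1 else 0)" for u
    using is_variational_spline_lagrangian_spline[OF assms(1,2)] assms(3)
    by (auto simp: is_variational_spline_def)
  then have "lagrangian_interpolant w U f k \<epsilon> $ v = (\<Sum>u\<in>U. if u = v then f $ u else 0)"
    unfolding lagrangian_interpolant_def sum_component vector_scaleR_component
    by (intro sum.cong) auto
  with assms(3) show ?thesis by simp
qed

lemma lagrangian_interpolant_orthogonal: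
  assumes "weighted_graph w" and "\<epsilon> > 0" and "\<forall>u\<in>U. Z $ u = 0"
  shows "(shifted_laplacian w \<epsilon> ^^ k) (lagrangian_interpolant w U f k \<epsilon>)
    \<bullet> (shifted_laplacian w \<epsilon> ^^ k) Z = 0"
  using linear_shifted_laplacian_power[of k w \<epsilon>]
    spline_orthogonal[OF is_variational_spline_lagrangian_spline[OF assms(1,2)] assms(3)]
  by (simp add: lagrangian_interpolant_def linear_sum linear_scale inner_sum_left)

lemma sum_lagrangian_interpolant:
  "(\<Sum>v\<in>UNIV. lagrangian_interpolant w U f k \<epsilon> $ v) = (\<Sum>u\<in>U. f $ u * spline_weight w U k \<epsilon> u)"
  by (simp add: lagrangian_interpolant_def spline_weight_def sum_distrib_left)
    (rule sum.swap)

text \<open>With \<open>Z = h - Y\<close>, the point \<open>h\<close> and its mirror image are \<open>Y + Z\<close> and \<open>Y - Z\<close>. Since \<open>Z\<close>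
  vanishes on \<open>U\<close>, the cross term in the squared norms of their images is zero.\<close>

lemma Q_set_reflection:
  assumes "weighted_graph w" and "\<epsilon> > 0" and h: "h \<in> Q_set w U f k \<epsilon> R"
  shows "2 *\<^sub>R lagrangian_interpolant w U f k \<epsilon> - h \<in> Q_set w U f k \<epsilon> R"
proof -
  define A where "A = shifted_laplacian w \<epsilon> ^^ k"
  define Y where "Y = lagrangian_interpolant w U f k \<epsilon>"
  define Z where "Z = h - Y"
  have lin: "linear A" unfolding A_def by (rule linear_shifted_laplacian_power)
  have Yf: "Y $ u = f $ u" if "u \<in> U" for u
    using lagrangian_interpolant_nth[OF assms(1,2) that] by (simp add: Y_def)
  have hf: "h $ u = f $ u" if "u \<in> U" for u
    using h that by (simp add: Q_set_def)
  have "\<forall>u\<in>U. Z $ u = 0" by (simp add: Z_def Yf hf)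
  then have orth: "A Y \<bullet> A Z = 0"
    unfolding A_def Y_def by (rule lagrangian_interpolant_orthogonal[OF assms(1,2)])
  have "A (2 *\<^sub>R Y - h) = A (Y - Z)"
    by (simp add: Z_def scaleR_2 algebra_simps)
  also have "norm \<dots> = norm (A (Y + Z))"
    using orth lin
    by (simp add: norm_eq linear_add linear_diff inner_add_left inner_add_right inner_diff_left
        inner_diff_right inner_commute)
  also have "Y + Z = h" by (simp add: Z_def)
  finally have "norm (A (2 *\<^sub>R Y - h)) \<le> R"
    using h by (simp add: Q_set_def A_def)
  then show ?thesis
    by (simp add: Q_set_def Yf hf flip: A_def Y_def)
qed

lemma convex_Q_set: "convex (Q_set w U f k \<epsilon> R)"
proof (rule convexI)
  fix g h and s t :: real
  assume gh: "g \<in> Q_set w U f k \<epsilon> R" "h \<in> Q_set w U f k \<epsilon> R" and st: "0 \<le> s" "0 \<le> t" "s + t = 1"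
  define A where "A = shifted_laplacian w \<epsilon> ^^ k"
  have lin: "linear A" unfolding A_def by (rule linear_shifted_laplacian_power)
  have "s *\<^sub>R A g + t *\<^sub>R A h \<in> cball 0 R"
    using gh st by (intro convexD[OF convex_cball]) (auto simp: Q_set_def A_def)
  then have "norm (A (s *\<^sub>R g + t *\<^sub>R h)) \<le> R"
    using lin by (simp add: linear_add linear_scale)
  moreover have "s * c + t * c = c" for c :: real
    using st(3) by (metis distrib_right mult_1)
  ultimately show "s *\<^sub>R g + t *\<^sub>R h \<in> Q_set w U f k \<epsilon> R"
    using gh by (simp add: Q_set_def A_def)
qed

text \<open>Boundedness comes from the injectivity of \<open>(\<epsilon> I + \<L>)\<^sup>k\<close>: in finite dimension an injective
  linear map is bounded below by a positive multiple of the norm.\<close>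

lemma compact_Q_set:
  assumes "weighted_graph w" and "\<epsilon> > 0"
  shows "compact (Q_set w U f k \<epsilon> R)"
proof -
  define A where "A = shifted_laplacian w \<epsilon> ^^ k"
  have lin: "linear A" unfolding A_def by (rule linear_shifted_laplacian_power)
  have inj: "inj A" unfolding A_def by (rule inj_shifted_laplacian_power[OF assms])
  have cont: "continuous_on UNIV A"
    by (rule linear_continuous_on) (simp add: lin linear_conv_bounded_linear[symmetric])
  obtain B where B: "B > 0" "\<And>x. B * norm x \<le> norm (A x)"
    using linear_inj_bounded_below_pos[OF lin inj] by blast
  have "norm x \<le> R / B" if "x \<in> Q_set w U f k \<epsilon> R" for x
  proof -
    have "B * norm x \<le> R"
      using B(2)[of x] that by (simp add: Q_set_def A_def)
    with B(1) show ?thesis by (simp add: pos_le_divide_eq mult.commute)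
  qed
  then have "bounded (Q_set w U f k \<epsilon> R)" by (auto simp: bounded_iff)
  moreover have "closed (Q_set w U f k \<epsilon> R)"
  proof -
    have "Q_set w U f k \<epsilon> R = (\<Inter>u\<in>U. {h. h $ u = f $ u}) \<inter> {h. norm (A h) \<le> R}"
      by (auto simp: Q_set_def A_def)
    moreover have "closed {h :: real ^ 'a. h $ u = f $ u}" for u
      by (intro closed_Collect_eq continuous_intros)
    moreover have "closed {h. norm (A h) \<le> R}"
      by (intro closed_Collect_le continuous_intros cont)
    ultimately show ?thesis
      by (metis (no_types, lifting) closed_INT closed_Int)
  qed
  ultimately show ?thesis by (simp add: compact_eq_bounded_closed)
qed

theorem theorem3p4:
  fixes w :: "'v::finite \<Rightarrow> 'v \<Rightarrow> real"
    and U :: "'v set"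
    and \<epsilon> R :: real
    and k l :: nat
    and f :: "real ^ 'v"
  assumes "weighted_graph w"
    and "\<epsilon> > 0"
    and "k = 2 ^ l"
    and "R > 0"
  shows "\<exists>a b :: real.
           {(\<Sum>v\<in>UNIV. h $ v) | h. h \<in> Q_set w U f k \<epsilon> R} = {a..b} \<and>
           (\<forall>g \<in> Q_set w U f k \<epsilon> R. (\<Sum>u\<in>U. g $ u * spline_weight w U k \<epsilon> u) = (a + b) / 2)"
proof -
  define Q where "Q = Q_set w U f k \<epsilon> R"
  define \<sigma> :: "real ^ 'v \<Rightarrow> real" where "\<sigma> = (\<lambda>h. \<Sum>v\<in>UNIV. h $ v)"
  define c where "c = (\<Sum>u\<in>U. f $ u * spline_weight w U k \<epsilon> u)"
  have lin: "linear \<sigma>"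
    by (rule linearI) (simp_all add: \<sigma>_def sum.distrib sum_distrib_left)
  have cont: "continuous_on Q \<sigma>"
    unfolding \<sigma>_def by (intro continuous_intros)
  have "compact (\<sigma> ` Q)"
    using cont compact_Q_set[OF assms(1,2)] unfolding Q_def by (rule compact_continuous_image)
  moreover have "connected (\<sigma> ` Q)"
    using convex_linear_image[OF lin convex_Q_set] unfolding Q_def by (rule convex_connected)
  ultimately obtain a b where ab: "\<sigma> ` Q = {a..b}"
    using connected_compact_interval_1[of "\<sigma> ` Q"] by auto
  have sym: "2 * c - s \<in> {a..b}" if s: "s \<in> {a..b}" for s
  proof -
    from s ab obtain h where h: "h \<in> Q" "s = \<sigma> h" by blast
    have "\<sigma> (2 *\<^sub>R lagrangian_interpolant w U f k \<epsilon> - h)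
        = 2 * \<sigma> (lagrangian_interpolant w U f k \<epsilon>) - \<sigma> h"
      using lin by (simp add: linear_diff linear_scale)
    also have "\<sigma> (lagrangian_interpolant w U f k \<epsilon>) = c"
      unfolding \<sigma>_def c_def by (rule sum_lagrangian_interpolant)
    finally have "2 * c - s = \<sigma> (2 *\<^sub>R lagrangian_interpolant w U f k \<epsilon> - h)"
      using h(2) by simp
    then show ?thesis
      using Q_set_reflection[OF assms(1,2) h(1)[unfolded Q_def]] ab unfolding Q_def by blast
  qed
  have "(\<Sum>u\<in>U. g $ u * spline_weight w U k \<epsilon> u) = (a + b) / 2" if g: "g \<in> Q" for g
  proof -
    have "(\<Sum>u\<in>U. g $ u * spline_weight w U k \<epsilon> u) = c"
      using g by (simp add: Q_def Q_set_def c_def)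
    \<comment> \<open>The reflections of the two end points lie in the interval, which gives
        \<open>2 * c - a \<le> b\<close> and \<open>a \<le> 2 * c - b\<close>.\<close>
    moreover from g ab have "a \<le> b" by (metis atLeastAtMost_iff image_eqI order_trans)
    then have "2 * c - a \<le> b" "a \<le> 2 * c - b"
      using sym[of a] sym[of b] by auto
    ultimately show ?thesis by simp
  qed
  moreover have "{(\<Sum>v\<in>UNIV. h $ v) | h. h \<in> Q} = {a..b}"
    using ab by (auto simp: \<sigma>_def)
  ultimately show ?thesis
    unfolding Q_def by blast
qed

end
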